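(* Let $\mathcal{A}={\rm diag}(\mathcal{A}_1,\mathcal{A}_2)\in\mathbb{C}_t^{n,n}$ be a diagonal block tensor, and let $\mathcal{A}_1^{(1)_k}$ and $\mathcal{A}_2^{(1)_k}$ denote order $k$ $\{1\}$ inverses of $\mathcal{A}_1$ and $\mathcal{A}_2$ respectively. Then ${\rm diag}(\mathcal{A}_1^{(1)_k},\mathcal{A}_2^{(1)_k})\in\mathbb{C}_{k}^{n,n}$ is an order $k$ $\{1\}$ inverse of $\mathcal{A}$.
   Context: $[n]=\{1,\ldots,n\}$. $\mathbb{C}_{t}^{m,n}$ is the set of all order $t$ complex tensors $\mathcal{A}=(a_{i_1\cdots i_t})$ of dimension $m\times n\times\cdots\times n$ ($i_1\in[m]$, $i_2,\ldots,i_t\in[n]$). For $x\in\mathbb{C}^n$, $\mathcal{A}\cdot x^{t-1}\in\mathbb{C}^m$ has components $(\mathcal{A}\cdot x^{t-1})_i=\sum_{i_2,\ldots,i_t\in[n]}a_{ii_2\cdots i_t}x_{i_2}\cdots x_{i_t}$. For a vector $x$, $x^{[r]}=(x_1^r,\ldots,x_n^r)^{\mathrm T}$ (componentwise power; for $r=1/s$ this is the componentwise $s$-th root, no branch being specified in the paper). $\mathcal{A}\in\mathbb{C}_t^{n,n}$ is a diagonal block tensor $\mathcal{A}={\rm diag}(\mathcal{A}_1,\mathcal{A}_2)$ if, for some positive integer $r\le n$, $\mathcal{A}_1=(a_{i_1\cdots i_t})$ with $i_1,\ldots,i_t\le r$, $\mathcal{A}_2=(a_{i_1\cdots i_t})$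 with $i_1,\ldots,i_t>r$, and all other entries of $\mathcal{A}$ are zero; ${\rm diag}$ of two order $k$ tensors of dimensions $r$ and $n-r$ is the corresponding tensor in $\mathbb{C}_k^{n,n}$. General tensor product: for $\mathcal{A}\in\mathbb{C}_t^{m,n}$, $\mathcal{B}\in\mathbb{C}_k^{n,m}$, $\mathcal{A}\mathcal{B}\in\mathbb{C}_{(t-1)(k-1)+1}^{m,m}$ has entries $(\mathcal{A}\mathcal{B})_{i\alpha_1\cdots\alpha_{t-1}}=\sum_{i_2,\ldots,i_t\in[n]}a_{ii_2\cdots i_t}b_{i_2\alpha_1}\cdots b_{i_t\alpha_{t-1}}$, $i\in[m]$, $\alpha_1,\ldots,\alpha_{t-1}\in[m]^{k-1}$. $\mathcal{X}\in\mathbb{C}_k^{n,m}$ is an order $k$ $\{1\}$ inverse of $\mathcal{A}\in\mathbb{C}_t^{m,n}$ if $\mathcal{A}\mathcal{X}\cdot[(\mathcal{A}\cdot y^{t-1})^{[\frac1s]}]^s=\mathcal{A}\cdot y^{t-1}$ for all $y\in\mathbb{C}^n$, where $s=(t-1)(k-1)$. *)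

theory Defs
  imports Complex_Main "HOL-Library.FuncSet"
begin

text \<open>
  Dimensions are natural numbers and indices run over \<open>[n] = {1..n}\<close>. Vectors and tensors are
  extensional functions, so that equality of functions is equality of all entries; a tensor of
  order \<open>t\<close> takes the list \<open>[i\<^sub>1, \<dots>, i\<^sub>t]\<close> of its indices.
\<close>

definition cvec :: "nat \<Rightarrow> (nat \<Rightarrow> complex) set" where
  "cvec n = {1..n} \<rightarrow>\<^sub>E UNIV"

definition multi_index :: "nat \<Rightarrow> nat \<Rightarrow> nat list set" where
  "multi_index n p = {J. set J \<subseteq> {1..n} \<and> length J = p}"

definition tensor_index :: "nat \<Rightarrow> nat \<Rightarrow> nat \<Rightarrow> nat list set" where
  "tensor_index t m n = {i # J |i J. i \<in> {1..m} \<and> set J \<subseteq> {1..n} \<and> Suc (length J) = t}"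

definition ctensor :: "nat \<Rightarrow> nat \<Rightarrow> nat \<Rightarrow> (nat list \<Rightarrow> complex) set" where
  "ctensor t m n = tensor_index t m n \<rightarrow>\<^sub>E UNIV"

text \<open>The vector \<open>A \<cdot> x\<^sup>t\<^sup>-\<^sup>1\<close> for \<open>A\<close> in \<open>ctensor t m n\<close> and \<open>x\<close> in \<open>cvec n\<close>.\<close>

definition tensor_apply ::
  "nat \<Rightarrow> nat \<Rightarrow> nat \<Rightarrow> (nat list \<Rightarrow> complex) \<Rightarrow> (nat \<Rightarrow> complex) \<Rightarrow> nat \<Rightarrow> complex" where
  "tensor_apply t m n A x =
     (\<lambda>i\<in>{1..m}. \<Sum>J\<in>multi_index n (t - 1). A (i # J) * (\<Prod>j<t - 1. x (J ! j)))"

text \<open>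
  The general product of \<open>A\<close> in \<open>ctensor t m n\<close> and \<open>B\<close> in \<open>ctensor k n m\<close>. Its index list is
  \<open>i # \<alpha>\<^sub>1 @ \<dots> @ \<alpha>\<^sub>t\<^sub>-\<^sub>1\<close> with blocks \<open>\<alpha>\<^sub>j\<close> of length \<open>k - 1\<close>, which are cut out by
  \<^const>\<open>take\<close> and \<^const>\<open>drop\<close>.
\<close>

definition tensor_prod ::
  "nat \<Rightarrow> nat \<Rightarrow> nat \<Rightarrow> nat \<Rightarrow> (nat list \<Rightarrow> complex) \<Rightarrow> (nat list \<Rightarrow> complex) \<Rightarrow> nat list \<Rightarrow> complex"
where
  "tensor_prod t k m n A B =
     (\<lambda>I\<in>tensor_index ((t - 1) * (k - 1) + 1) m m.
        \<Sum>J\<in>multi_index n (t - 1).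
          A (hd I # J) * (\<Prod>j<t - 1. B (J ! j # take (k - 1) (drop (j * (k - 1)) (tl I)))))"

text \<open>The order \<open>t\<close> tensor \<open>diag(B, C)\<close> of dimension \<open>n\<close>, with blocks of dimensions \<open>r\<close> and \<open>n - r\<close>.\<close>

definition tensor_diag ::
  "nat \<Rightarrow> nat \<Rightarrow> nat \<Rightarrow> (nat list \<Rightarrow> complex) \<Rightarrow> (nat list \<Rightarrow> complex) \<Rightarrow> nat list \<Rightarrow> complex" where
  "tensor_diag t n r B C =
     (\<lambda>I\<in>tensor_index t n n.
        if set I \<subseteq> {1..r} then B I
        else if set I \<subseteq> {r<..n} then C (map (\<lambda>i. i - r) I)
        else 0)"

text \<open>
  The complex root \<open>w\<^bsup>1/s\<^esup>\<close> needs a choice of branch. It is kept as a parameter: \<open>R w\<close> is the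
  set of admissible values of \<open>w\<^bsup>1/s\<^esup>\<close>. A singleton-valued \<open>R\<close> is a fixed branch (such as the
  principal one); \<open>R w = {z. z ^ s = w}\<close> is the multivalued root.
\<close>

definition root_convention :: "nat \<Rightarrow> (complex \<Rightarrow> complex set) \<Rightarrow> bool" where
  "root_convention s R \<longleftrightarrow> (\<forall>w. R w \<noteq> {} \<and> (\<forall>z\<in>R w. z ^ s = w))"

text \<open>
  \<open>X\<close> is an order \<open>k\<close> \<open>{1}\<close> inverse of \<open>A\<close>: the vector \<open>z\<close> below is any value of
  \<open>(A \<cdot> y\<^sup>t\<^sup>-\<^sup>1)\<close> to the componentwise power \<open>1/s\<close>, where \<open>s = (t - 1) (k - 1)\<close>, and the product
  of \<open>A\<close> and \<open>X\<close> has order \<open>s + 1\<close>.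
\<close>

definition is_one_inverse ::
  "(complex \<Rightarrow> complex set) \<Rightarrow> nat \<Rightarrow> nat \<Rightarrow> nat \<Rightarrow> nat \<Rightarrow>
   (nat list \<Rightarrow> complex) \<Rightarrow> (nat list \<Rightarrow> complex) \<Rightarrow> bool" where
  "is_one_inverse R t k m n A X \<longleftrightarrow>
     A \<in> ctensor t m n \<and> X \<in> ctensor k n m \<and>
     (\<forall>y\<in>cvec n. \<forall>z\<in>cvec m.
        (\<forall>i\<in>{1..m}. z i \<in> R (tensor_apply t m n A y i)) \<longrightarrow>
        tensor_apply ((t - 1) * (k - 1) + 1) m m (tensor_prod t k m n A X) z
          = tensor_apply t m n A y)"

end

theory Submission imports Defs begin

text \<open>
  The tensor product is designed so that \<open>(A X) \<cdot> z\<^sup>s = A \<cdot> (X \<cdot> z\<^sup>k\<^sup>-\<^sup>1)\<^sup>t\<^sup>-\<^sup>1\<close>, and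
  a diagonal block tensor acts separately on the first \<open>r\<close> and the last \<open>n - r\<close> coordinates.
  Hence the \<open>{1}\<close> inverse equation for \<open>diag(A1, A2)\<close> and \<open>diag(X1, X2)\<close> splits into those for
  the two blocks. Because the roots are taken componentwise, an admissible root of \<open>A \<cdot> y\<^sup>t\<^sup>-\<^sup>1\<close>
  restricts to admissible roots on both blocks, for whatever branch convention.
\<close>

section \<open>Block decomposition of index lists and the composition law of the tensor
  product\<close>

lemma finite_multi_index [simp]: "finite (multi_index n p)"
  unfolding multi_index_def by (rule finite_lists_length_eq) simp

lemma multi_index_nth: "J \<in> multi_index n p \<Longrightarrow> j < p \<Longrightarrow> J ! j \<in> {1..n}"
  unfolding multi_index_def using nth_mem by blast

lemma sum_multi_index_add:
  "(\<Sum>L\<in>multi_index m (p + q). g L)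
    = (\<Sum>a\<in>multi_index m p. \<Sum>b\<in>multi_index m q. g (a @ b))"
proof -
  have "bij_betw (\<lambda>(a, b). a @ b) (multi_index m p \<times> multi_index m q) (multi_index m (p + q))"
  proof (rule bij_betw_byWitness[where f' = "\<lambda>L. (take p L, drop p L)"])
    show "(\<lambda>L. (take p L, drop p L)) ` multi_index m (p + q)
        \<subseteq> multi_index m p \<times> multi_index m q"
      unfolding multi_index_def by (auto dest: in_set_takeD in_set_dropD)
  qed (auto simp: multi_index_def subset_iff)
  then show ?thesis
    by (simp add: sum.reindex_bij_betw[symmetric] sum.cartesian_product case_prod_unfold)
qed

text \<open>A list of length \<open>p * q\<close> is a free choice of \<open>p\<close> blocks of
  length \<open>q\<close>, and each factor sees only its own block, so the distributive law applies.
  \<open>f\<close> is generalised because removing the first block shifts the remaining factors to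
  \<open>f (Suc j)\<close>.\<close>

lemma sum_multi_index_blocks:
  fixes f :: "nat \<Rightarrow> nat list \<Rightarrow> complex"
  shows "(\<Sum>L\<in>multi_index m (p * q). \<Prod>j<p. f j (take q (drop (j * q) L)))
    = (\<Prod>j<p. \<Sum>a\<in>multi_index m q. f j a)"
proof (induction p arbitrary: f)
  case 0
  have "multi_index m 0 = {[]}"
    by (auto simp: multi_index_def)
  then show ?case by simp
next
  case (Suc p)
  have "(\<Sum>L\<in>multi_index m (Suc p * q). \<Prod>j<Suc p. f j (take q (drop (j * q) L)))
      = (\<Sum>a\<in>multi_index m q. \<Sum>b\<in>multi_index m (p * q).
           f 0 a * (\<Prod>j<p. f (Suc j) (take q (drop (j * q) b))))"
    \<comment> \<open>\<open>Suc p * q\<close> unfolds to \<open>q + p * q\<close>, which splits off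
      the first block; hence the product must also lose its first factor rather than its
      last.\<close>
    unfolding mult_Suc sum_multi_index_add
    by (intro sum.cong refl)
      (auto simp: multi_index_def prod.lessThan_Suc_shift simp del: prod.lessThan_Suc)
  also have "\<dots> = (\<Sum>a\<in>multi_index m q. f 0 a)
      * (\<Prod>j<p. \<Sum>a\<in>multi_index m q. f (Suc j) a)"
    by (simp only: sum_product[symmetric] Suc.IH[of "\<lambda>j. f (Suc j)"])
  also have "\<dots> = (\<Prod>j<Suc p. \<Sum>a\<in>multi_index m q. f j a)"
    by (simp add: prod.lessThan_Suc_shift del: prod.lessThan_Suc)
  finally show ?case .
qed

lemma prod_nth_blocks:
  fixes z :: "nat \<Rightarrow> complex"
  assumes "length L = p * q"
  shows "(\<Prod>l<p * q. z (L ! l)) = (\<Prod>j<p. \<Prod>l<q. z (take q (drop (j * q) L) ! l))"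
proof -
  have "(\<Prod>l<p * q. z (L ! l)) = (\<Prod>j<p. \<Prod>l=j * q..<j * q + q. z (L ! l))"
    by (rule prod.nat_group[symmetric])
  also have "\<dots> = (\<Prod>j<p. \<Prod>l<q. z (take q (drop (j * q) L) ! l))"
  proof (rule prod.cong[OF refl])
    fix j assume "j \<in> {..<p}"
    \<comment> \<open>Block \<open>j\<close> ends inside \<open>L\<close>, so \<open>take\<close>
      and \<open>drop\<close> do not run past the end.\<close>
    then have "j * q + q \<le> length L"
      using assms mult_le_mono1[of "Suc j" p q] by simp
    then have "z (take q (drop (j * q) L) ! l) = z (L ! (l + j * q))" if "l < q" for l
      using that by (simp add: add.commute)
    then show "(\<Prod>l=j * q..<j * q + q. z (L ! l)) = (\<Prod>l<q. z (take q (drop (j * q) L) ! l))"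
      using prod.shift_bounds_nat_ivl[of "\<lambda>l. z (L ! l)" 0 "j * q" q]
      by (simp add: atLeast0LessThan add.commute)
  qed
  finally show ?thesis .
qed

text \<open>Each block of the long index occurs in one entry of \<open>X\<close> and in its own
  group of \<open>q\<close> coordinates of \<open>z\<close>. Summing over the blocks independently
  turns each factor into a component of the vector \<open>tensor_apply k n m X z\<close>.\<close>

lemma tensor_apply_tensor_prod:
  "tensor_apply ((t - 1) * (k - 1) + 1) m m (tensor_prod t k m n A X) z
    = tensor_apply t m n A (tensor_apply k n m X z)"
proof
  fix i
  define p q where "p = t - 1" and "q = k - 1"
  show "tensor_apply ((t - 1) * (k - 1) + 1) m m (tensor_prod t k m n A X) z i
    = tensor_apply t m n A (tensor_apply k n m X z) i"
  proof (cases "i \<in> {1..m}")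
    case True
    let ?b = "\<lambda>j L. take q (drop (j * q) L)"
    let ?f = "\<lambda>J j a. X (J ! j # a) * (\<Prod>l<q. z (a ! l))"
    have "tensor_apply (p * q + 1) m m (tensor_prod t k m n A X) z i
      = (\<Sum>L\<in>multi_index m (p * q). (\<Sum>J\<in>multi_index n p.
          A (i # J) * (\<Prod>j<p. X (J ! j # ?b j L))) * (\<Prod>l<p * q. z (L ! l)))"
      using True unfolding tensor_apply_def tensor_prod_def p_def[symmetric] q_def[symmetric]
      by (auto intro!: sum.cong simp: tensor_index_def multi_index_def)
    also have "\<dots> = (\<Sum>L\<in>multi_index m (p * q). \<Sum>J\<in>multi_index n p.
          A (i # J) * (\<Prod>j<p. ?f J j (?b j L)))"
    proof (rule sum.cong[OF refl])
      fix L assume "L \<in> multi_index m (p * q)"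
      then have "length L = p * q" by (simp add: multi_index_def)
      then show "(\<Sum>J\<in>multi_index n p. A (i # J) * (\<Prod>j<p. X (J ! j # ?b j L)))
            * (\<Prod>l<p * q. z (L ! l))
          = (\<Sum>J\<in>multi_index n p. A (i # J) * (\<Prod>j<p. ?f J j (?b j L)))"
        by (simp only: prod_nth_blocks sum_distrib_right prod.distrib mult.assoc)
    qed
    \<comment> \<open>After the swap \<open>J\<close> is fixed in the inner sum, whose
      \<open>j\<close>-th factor depends on \<open>L\<close> only through block
      \<open>j\<close>.\<close>
    also have "\<dots> = (\<Sum>J\<in>multi_index n p. A (i # J) *
        (\<Sum>L\<in>multi_index m (p * q). \<Prod>j<p. ?f J j (?b j L)))"
      by (subst sum.swap) (simp only: sum_distrib_left)
    also have "\<dots> = (\<Sum>J\<in>multi_index n p. A (i # J) *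
        (\<Prod>j<p. \<Sum>a\<in>multi_index m q. ?f J j a))"
      by (simp only: sum_multi_index_blocks[where f = "?f J" for J])
    \<comment> \<open>The entries \<open>J ! j\<close> lie in \<open>{1..n}\<close>, where the
      restricted function \<open>tensor_apply k n m X z\<close> takes its defining value.\<close>
    also have "\<dots> = tensor_apply t m n A (tensor_apply k n m X z) i"
      using True multi_index_nth[of _ n p]
      unfolding tensor_apply_def p_def[symmetric] q_def[symmetric]
      by (auto intro!: sum.cong prod.cong)
    finally show ?thesis by (simp only: p_def q_def)
  qed (simp only: tensor_apply_def restrict_def if_False)
qed

section \<open>Restriction to coordinate blocks and the action of diagonal block tensors\<close>

definition subvec :: "nat \<Rightarrow> nat \<Rightarrow> (nat \<Rightarrow> complex) \<Rightarrow> nat \<Rightarrow> complex" where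
  "subvec d m x = (\<lambda>j\<in>{1..m}. x (j + d))"

lemma subvec_cvec: "subvec d m x \<in> cvec m"
  by (simp add: subvec_def cvec_def)

lemma eq_if_subvecs_eq:
  assumes "x \<in> extensional {1..n}" "y \<in> extensional {1..n}" "r \<le> n"
    and "subvec 0 r x = subvec 0 r y" "subvec r (n - r) x = subvec r (n - r) y"
  shows "x = y"
proof (rule extensionalityI[OF assms(1,2)])
  fix i assume i: "i \<in> {1..n}"
  show "x i = y i"
  proof (cases "i \<le> r")
    case True
    then show ?thesis
      using i fun_cong[OF assms(4), of i] by (simp add: subvec_def)
  next
    case False
    then have "i - r \<in> {1..n - r}" "i - r + r = i"
      using i by auto
    then show ?thesis
      using fun_cong[OF assms(5), of "i - r"] by (simp add: subvec_def)
  qed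
qed

lemma tensor_apply_extensional: "tensor_apply t m n A x \<in> extensional {1..m}"
  by (simp add: tensor_apply_def)

text \<open>The hypothesis \<open>zero\<close> discards all index lists that leave the block, and
  the surviving ones are shifts by \<open>d\<close> of lists over \<open>{1..m}\<close>. The offset
  \<open>d\<close> lets one argument serve both blocks, with \<open>d = 0\<close> and
  \<open>d = r\<close>.\<close>

lemma subvec_tensor_apply:
  assumes "d + m \<le> n"
    and block: "\<And>i J. i \<in> {1..m} \<Longrightarrow> J \<in> multi_index m (t - 1) \<Longrightarrow>
      D ((i + d) # map (\<lambda>j. j + d) J) = B (i # J)"
    and zero: "\<And>i J. i \<in> {1..m} \<Longrightarrow> J \<in> multi_index n (t - 1) \<Longrightarrow>
      \<not> set J \<subseteq> {d<..d + m} \<Longrightarrow> D ((i + d) # J) = 0"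
  shows "subvec d m (tensor_apply t n n D x) = tensor_apply t m m B (subvec d m x)"
proof
  fix i
  show "subvec d m (tensor_apply t n n D x) i = tensor_apply t m m B (subvec d m x) i"
  proof (cases "i \<in> {1..m}")
    case True
    define p where "p = t - 1"
    let ?h = "map (\<lambda>j. j + d)"
    let ?M = "{J \<in> multi_index n p. set J \<subseteq> {d<..d + m}}"
    have bij: "bij_betw ?h (multi_index m p) ?M"
    proof (rule bij_betw_byWitness[where f' = "map (\<lambda>j. j - d)"])
      show "\<forall>J\<in>?M. ?h (map (\<lambda>j. j - d) J) = J"
        by (auto simp: subset_iff intro!: map_idI)
      show "?h ` multi_index m p \<subseteq> ?M"
        using assms(1) by (fastforce simp: multi_index_def)
      show "map (\<lambda>j. j - d) ` ?M \<subseteq> multi_index m p"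
        by (fastforce simp: multi_index_def)
    qed (simp add: comp_def)
    have "subvec d m (tensor_apply t n n D x) i
        = (\<Sum>J\<in>multi_index n p. D ((i + d) # J) * (\<Prod>j<p. x (J ! j)))"
      using True assms(1) by (simp add: subvec_def tensor_apply_def p_def)
    also have "\<dots> = (\<Sum>J\<in>?M. D ((i + d) # J) * (\<Prod>j<p. x (J ! j)))"
      by (rule sum.mono_neutral_right) (use True zero in \<open>auto simp: p_def\<close>)
    also have "\<dots> = (\<Sum>J\<in>multi_index m p. D ((i + d) # ?h J) * (\<Prod>j<p. x (?h J ! j)))"
      by (rule sum.reindex_bij_betw[OF bij, symmetric])
    also have "\<dots> = (\<Sum>J\<in>multi_index m p. B (i # J) * (\<Prod>j<p. subvec d m x (J ! j)))"
    proof (rule sum.cong[OF refl])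
      fix J assume J: "J \<in> multi_index m p"
      then have "x (?h J ! j) = subvec d m x (J ! j)" if "j < p" for j
        using that multi_index_nth[OF J that] by (simp add: subvec_def multi_index_def)
      then show "D ((i + d) # ?h J) * (\<Prod>j<p. x (?h J ! j))
          = B (i # J) * (\<Prod>j<p. subvec d m x (J ! j))"
        using True J block by (simp add: p_def)
    qed
    also have "\<dots> = tensor_apply t m m B (subvec d m x) i"
      using True by (simp add: tensor_apply_def p_def)
    finally show ?thesis .
  next
    case False
    then show ?thesis
      by (simp only: subvec_def tensor_apply_def restrict_def if_False)
  qed
qed

lemma subvec_tensor_apply_diag:
  assumes "1 \<le> t" "r \<le> n"
  shows "subvec 0 r (tensor_apply t n n (tensor_diag t n r B C) x)
      = tensor_apply t r r B (subvec 0 r x)" (is ?first)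
    and "subvec r (n - r) (tensor_apply t n n (tensor_diag t n r B C) x)
      = tensor_apply t (n - r) (n - r) C (subvec r (n - r) x)" (is ?second)
proof -
  \<comment> \<open>Here \<open>1 \<le> t\<close> matters: for \<open>t = 0\<close> the truncated
    \<open>t - 1\<close> would still admit the empty list \<open>J\<close>, although
    \<open>tensor_index 0 n n\<close> is empty.\<close>
  have index: "i # J \<in> tensor_index t n n"
    if "i \<in> {1..n}" "J \<in> multi_index n (t - 1)" for i J
    using that assms(1) by (auto simp: tensor_index_def multi_index_def)
  show ?first
  proof (rule subvec_tensor_apply)
    fix i J assume i: "i \<in> {1..r}" and J: "J \<in> multi_index r (t - 1)"
    have "J \<in> multi_index n (t - 1)"
      using J assms(2) by (fastforce simp: multi_index_def)
    then show "tensor_diag t n r B C ((i + 0) # map (\<lambda>j. j + 0) J) = B (i # J)"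
      using i J assms(2) index[of i J] by (simp add: tensor_diag_def multi_index_def)
  next
    \<comment> \<open>The head lies in the first block and the tail leaves it, so the whole list
      lies in neither block.\<close>
    fix i J assume "i \<in> {1..r}" "J \<in> multi_index n (t - 1)" "\<not> set J \<subseteq> {0<..0 + r}"
    moreover have "{0<..0 + r} = {1..r}"
      by auto
    ultimately show "tensor_diag t n r B C ((i + 0) # J) = 0"
      using index[of i J] assms(2) by (auto simp: tensor_diag_def)
  qed (use assms in simp)
  show ?second
  proof (rule subvec_tensor_apply)
    fix i J assume i: "i \<in> {1..n - r}" and J: "J \<in> multi_index (n - r) (t - 1)"
    have "map (\<lambda>j. j + r) J \<in> multi_index n (t - 1)"
      using J assms(2) by (fastforce simp: multi_index_def)
    moreover have "set (map (\<lambda>j. j + r) J) \<subseteq> {r<..n}"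
      using J assms(2) by (fastforce simp: multi_index_def)
    \<comment> \<open>The head \<open>i + r\<close> exceeds \<open>r\<close>, which rules out the
      first case of \<open>tensor_diag\<close>; the second case subtracts the shift again.\<close>
    ultimately show "tensor_diag t n r B C ((i + r) # map (\<lambda>j. j + r) J) = C (i # J)"
      using i assms(2) index[of "i + r" "map (\<lambda>j. j + r) J"]
      by (auto simp: tensor_diag_def comp_def)
  next
    fix i J assume i: "i \<in> {1..n - r}" and "J \<in> multi_index n (t - 1)"
      "\<not> set J \<subseteq> {r<..r + (n - r)}"
    moreover have "i + r \<in> {1..n}"
      using i assms(2) by auto
    ultimately show "tensor_diag t n r B C ((i + r) # J) = 0"
      using assms(2) index[of "i + r" J] by (auto simp: tensor_diag_def)
  qed (use assms in simp)
qed

section \<open>Assembling the inverses of the blocks\<close>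

lemma tensor_diag_ctensor: "tensor_diag t n r B C \<in> ctensor t n n"
  by (simp add: tensor_diag_def ctensor_def)

text \<open>By the composition law the inverse equation speaks only of successive actions on
  vectors, a form that restricts to blocks. The attribute \<open>simplified\<close> brings the order
  \<open>s + 1\<close> into the \<open>Suc\<close> form that the simplifier produces.\<close>

lemma is_one_inverseD:
  assumes "is_one_inverse R t k m n A X" "y \<in> cvec n" "z \<in> cvec m"
    and "\<And>i. i \<in> {1..m} \<Longrightarrow> z i \<in> R (tensor_apply t m n A y i)"
  shows "tensor_apply t m n A (tensor_apply k n m X z) = tensor_apply t m n A y"
  using assms by (simp add: is_one_inverse_def tensor_apply_tensor_prod[simplified])

theorem theorem2p6:
  fixes t k n r :: nat
    and R :: "complex \<Rightarrow> complex set"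
    and A A1 A2 X1 X2 :: "nat list \<Rightarrow> complex"
  assumes "t \<ge> 2" and "k \<ge> 2"
    and "1 \<le> r" and "r \<le> n"
    and "root_convention ((t - 1) * (k - 1)) R"
    and "A1 \<in> ctensor t r r" and "A2 \<in> ctensor t (n - r) (n - r)"
    and "A = tensor_diag t n r A1 A2"
    and "is_one_inverse R t k r r A1 X1"
    and "is_one_inverse R t k (n - r) (n - r) A2 X2"
  shows "tensor_diag k n r X1 X2 \<in> ctensor k n n
    \<and> is_one_inverse R t k n n A (tensor_diag k n r X1 X2)"
proof -
  let ?X = "tensor_diag k n r X1 X2"
  have t: "1 \<le> t" and k: "1 \<le> k" using assms(1,2) by auto
  note splitA = subvec_tensor_apply_diag[OF t assms(4), of A1 A2, folded assms(8)]
  note splitX = subvec_tensor_apply_diag[OF k assms(4), of X1 X2]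
  have "tensor_apply t n n A (tensor_apply k n n ?X z) = tensor_apply t n n A y"
    if root: "\<forall>i\<in>{1..n}. z i \<in> R (tensor_apply t n n A y i)" for y z
  proof -
    \<comment> \<open>Phrased with \<open>subvec\<close> outside so that \<open>splitA\<close> turns
      the argument of \<open>R\<close> into the action of \<open>A1\<close> or \<open>A2\<close> on
      a part of \<open>y\<close>.\<close>
    have root_block: "subvec d m z i \<in> R (subvec d m (tensor_apply t n n A y) i)"
      if "i \<in> {1..m}" "d + m \<le> n" for d m i
      using that root by (simp add: subvec_def)
    have "tensor_apply t r r A1 (tensor_apply k r r X1 (subvec 0 r z))
        = tensor_apply t r r A1 (subvec 0 r y)"
      by (rule is_one_inverseD[OF assms(9) subvec_cvec subvec_cvec])
        (use root_block[of _ r 0] assms(4) in \<open>simp add: splitA\<close>)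
    \<comment> \<open>For \<open>r = n\<close> this block has dimension 0, and both sides are
      undefined at every index.\<close>
    moreover have "tensor_apply t (n - r) (n - r) A2
          (tensor_apply k (n - r) (n - r) X2 (subvec r (n - r) z))
        = tensor_apply t (n - r) (n - r) A2 (subvec r (n - r) y)"
      by (rule is_one_inverseD[OF assms(10) subvec_cvec subvec_cvec])
        (use root_block[of _ "n - r" r] assms(4) in \<open>simp add: splitA\<close>)
    \<comment> \<open>Two vectors agree if both their parts do; \<open>splitA\<close> and then
      \<open>splitX\<close> move \<open>subvec\<close> inwards through the two actions until the
      block equations appear.\<close>
    ultimately show ?thesis
      by (intro eq_if_subvecs_eq[OF tensor_apply_extensional tensor_apply_extensional assms(4)])
        (simp_all only: splitA splitX)
  qed
  then have "is_one_inverse R t k n n A ?X"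
    unfolding is_one_inverse_def tensor_apply_tensor_prod
    using tensor_diag_ctensor assms(8) by blast
  then show ?thesis
    using tensor_diag_ctensor by blast
qed

end
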